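(* Let $0<q<1$. For all $z\in\mathbb{C}$ with $|z|<1$ and all $n,m\in\mathbb{Z}$, $$\sum_{k=-\infty}^\infty z^{k+n}\,\frac{(q^{n+k+1};q)_\infty}{(q;q)_\infty}\,{}_1\phi_1(0;q^{n+k+1};q,z^2)\; z^{k+m}\,\frac{(q^{m+k+1};q)_\infty}{(q;q)_\infty}\,{}_1\phi_1(0;q^{m+k+1};q,z^2)=\delta_{nm}$$ and $$\sum_{k=-\infty}^\infty z^{k+n}\,\frac{(z^2;q)_\infty}{(q;q)_\infty}\,{}_1\phi_1(0;z^2;q,q^{n+k+1})\; z^{k+m}\,\frac{(z^2;q)_\infty}{(q;q)_\infty}\,{}_1\phi_1(0;z^2;q,q^{m+k+1})=\delta_{nm},$$ where the sums on the left-hand sides are absolutely convergent, uniformly for $z$ in compact subsets of the open unit disk.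
   Context: For $0<q<1$ and $a\in\mathbb{C}$: $(a;q)_0:=1$, $(a;q)_k:=\prod_{j=0}^{k-1}(1-aq^j)$, $(a;q)_\infty:=\lim_{k\to\infty}(a;q)_k$. For $w\notin\{1,q^{-1},q^{-2},\dots\}$, ${}_1\phi_1(0;w;q,z):=\sum_{k=0}^\infty\frac{(-1)^k q^{k(k-1)/2} z^k}{(w;q)_k\,(q;q)_k}$. For every $w,z\in\mathbb{C}$ (including $w=q^{-l}$, $l=0,1,2,\dots$) the product $(w;q)_\infty\,{}_1\phi_1(0;w;q,z)$ is interpreted as the entire function $\sum_{k=0}^\infty\frac{(-1)^kq^{k(k-1)/2}(q^kw;q)_\infty z^k}{(q;q)_k}$. With this convention, for each integer $N$, each of the functions $z\mapsto z^{N}(q^{N+1};q)_\infty\,{}_1\phi_1(0;q^{N+1};q,z^2)$ and $z\mapsto z^{N}(z^2;q)_\infty\,{}_1\phi_1(0;z^2;q,q^{N+1})$ has at most a removable singularity at $z=0$, and at $z=0$ is given by its continuous extension. $\delta_{nm}$ is the Kronecker delta. *)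

theory Defs
  imports "HOL-Analysis.Analysis"
begin

definition qpoch :: "real \<Rightarrow> complex \<Rightarrow> nat \<Rightarrow> complex" where
  "qpoch q a k = (\<Prod>j<k. 1 - a * of_real q ^ j)"

definition qpoch_inf :: "real \<Rightarrow> complex \<Rightarrow> complex" where
  "qpoch_inf q a = lim (qpoch q a)"

text \<open>
  \<open>phi11 q w z\<close> is the series \<open>\<^sub>1\<phi>\<^sub>1(0;w;q,z)\<close>, meaningful for \<open>w\<close> outside
  \<open>{1, q\<^sup>-\<^sup>1, q\<^sup>-\<^sup>2, \<dots>}\<close>.  The symbol \<open>(w;q)\<^sub>\<infinity> \<^sub>1\<phi>\<^sub>1(0;w;q,z)\<close> denotes, for every \<open>w\<close>, the entire
  function \<open>qphi q w z\<close>; lemma \<open>qphi_eq\<close> below shows that it is the actual product whenever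
  the latter makes sense.
\<close>

definition phi11 :: "real \<Rightarrow> complex \<Rightarrow> complex \<Rightarrow> complex" where
  "phi11 q w z = (\<Sum>k. (-1) ^ k * of_real q ^ (k * (k - 1) div 2) * z ^ k
                      / (qpoch q w k * qpoch q (of_real q) k))"

definition qphi :: "real \<Rightarrow> complex \<Rightarrow> complex \<Rightarrow> complex" where
  "qphi q w z = (\<Sum>k. (-1) ^ k * of_real q ^ (k * (k - 1) div 2)
                     * qpoch_inf q (of_real q ^ k * w) * z ^ k / qpoch q (of_real q) k)"

definition extend_at_0 :: "(complex \<Rightarrow> complex) \<Rightarrow> complex \<Rightarrow> complex" where
  "extend_at_0 f z = (if z = 0 then Lim (at 0) f else f z)"

text \<open>
  The two factors, indexed by \<open>N = n + k\<close>.  For negative \<open>N\<close> the power \<open>z\<^sup>N\<close> is a genuine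
  negative power, so the value at \<open>z = 0\<close> is the limit, not what \<open>0 powi N\<close> would give.
\<close>

definition factor1 :: "real \<Rightarrow> int \<Rightarrow> complex \<Rightarrow> complex" where
  "factor1 q N = extend_at_0 (\<lambda>z. z powi N *
     (qphi q (of_real q powi (N + 1)) (z\<^sup>2) / qpoch_inf q (of_real q)))"

definition factor2 :: "real \<Rightarrow> int \<Rightarrow> complex \<Rightarrow> complex" where
  "factor2 q N = extend_at_0 (\<lambda>z. z powi N *
     (qphi q (z\<^sup>2) (of_real q powi (N + 1)) / qpoch_inf q (of_real q)))"

text \<open>
  The series of the \<open>f k\<close> over all integers converges absolutely, uniformly on compact subsets
  of \<open>S\<close>.  Since the terms \<open>norm (f k z)\<close> are nonnegative, uniform convergence along the net of
  finite index sets is the same as that of the symmetric partial sums.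
\<close>

definition abs_conv_compact_unif :: "complex set \<Rightarrow> (int \<Rightarrow> complex \<Rightarrow> complex) \<Rightarrow> bool" where
  "abs_conv_compact_unif S f \<longleftrightarrow>
     (\<forall>z\<in>S. (\<lambda>k. norm (f k z)) summable_on UNIV) \<and>
     (\<forall>K. compact K \<and> K \<subseteq> S \<longrightarrow>
        uniform_limit K (\<lambda>F z. \<Sum>k\<in>F. norm (f k z)) (\<lambda>z. \<Sum>\<^sub>\<infinity>k. norm (f k z))
          (finite_subsets_at_top UNIV))"

lemma convergent_prod_qpoch:
  assumes "0 < q" "q < 1"
  shows "convergent_prod (\<lambda>j. 1 - a * of_real q ^ j :: complex)"
proof -
  have "summable (\<lambda>j. norm ((1 - a * of_real q ^ j) - 1))"
    using assms by (auto simp: norm_mult norm_power intro!: summable_mult summable_geometric)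
  thus ?thesis
    by (intro abs_convergent_prod_imp_convergent_prod summable_imp_abs_convergent_prod)
qed

lemma qpoch_tendsto:
  assumes "0 < q" "q < 1"
  shows "qpoch q a \<longlonglongrightarrow> qpoch_inf q a"
proof -
  have "convergent (\<lambda>n. \<Prod>j\<le>n. 1 - a * of_real q ^ j)"
    using convergent_prod_qpoch[OF assms] by (rule convergent_prod_imp_convergent)
  hence "convergent (\<lambda>n. qpoch q a (Suc n))"
    by (simp add: qpoch_def lessThan_Suc_atMost)
  hence "convergent (qpoch q a)"
    using convergent_Suc_iff by blast
  thus ?thesis
    by (simp add: qpoch_inf_def convergent_LIMSEQ_iff)
qed

lemma qpoch_inf_split:
  assumes "0 < q" "q < 1"
  shows "qpoch_inf q a = qpoch q a k * qpoch_inf q (of_real q ^ k * a)"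
proof -
  have split: "qpoch q a (n + k) = qpoch q a k * qpoch q (of_real q ^ k * a) n" for n
    unfolding qpoch_def
    by (induction n) (auto simp: power_add mult_ac)
  have "(\<lambda>n. qpoch q a (n + k)) \<longlonglongrightarrow> qpoch_inf q a"
    using qpoch_tendsto[OF assms] by (rule LIMSEQ_ignore_initial_segment)
  moreover have "(\<lambda>n. qpoch q a (n + k)) \<longlonglongrightarrow> qpoch q a k * qpoch_inf q (of_real q ^ k * a)"
    unfolding split by (intro tendsto_mult tendsto_const qpoch_tendsto assms)
  ultimately show ?thesis
    by (rule LIMSEQ_unique)
qed

lemma qphi_eq:
  assumes q: "0 < q" "q < 1" and w: "\<And>l::nat. w \<noteq> inverse (of_real q ^ l)"
  shows "qphi q w z = qpoch_inf q w * phi11 q w z"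
proof -
  have fac: "1 - w * of_real q ^ j \<noteq> 0" for j
  proof
    assume "1 - w * of_real q ^ j = 0"
    hence "w = inverse (of_real q ^ j)"
      by (metis eq_iff_diff_eq_0 inverse_unique mult.commute)
    with w show False by blast
  qed
  have nz: "qpoch q w k \<noteq> 0" for k
    using fac by (simp add: qpoch_def)
  have nz_inf: "qpoch_inf q w \<noteq> 0"
  proof -
    have "convergent_prod (\<lambda>j. 1 - w * of_real q ^ j)"
      by (rule convergent_prod_qpoch[OF q])
    moreover have "1 - w * of_real q ^ j \<noteq> 0" for j
      using fac .
    ultimately have nz_prod: "prodinf (\<lambda>j. 1 - w * of_real q ^ j) \<noteq> 0"
      and lim1: "(\<lambda>n. \<Prod>j\<le>n. 1 - w * of_real q ^ j) \<longlonglongrightarrow> prodinf (\<lambda>j. 1 - w * of_real q ^ j)"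
      by (simp_all add: prodinf_nonzero convergent_prod_LIMSEQ)
    have "(\<lambda>n. \<Prod>j\<le>n. 1 - w * of_real q ^ j) \<longlonglongrightarrow> qpoch_inf q w"
      using LIMSEQ_Suc[OF qpoch_tendsto[OF q, of w]] by (simp add: qpoch_def lessThan_Suc_atMost)
    from LIMSEQ_unique[OF this lim1] nz_prod show ?thesis
      by simp
  qed
  define t where "t = (\<lambda>k. (-1) ^ k * of_real q ^ (k * (k - 1) div 2) * z ^ k
                      / (qpoch q w k * qpoch q (of_real q) k))"
  have "(-1) ^ k * of_real q ^ (k * (k - 1) div 2)
          * qpoch_inf q (of_real q ^ k * w) * z ^ k / qpoch q (of_real q) k
        = qpoch_inf q w * t k" for k
    using nz[of k] qpoch_inf_split[OF q, of w k] by (simp add: t_def)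
  hence "qphi q w z = (\<Sum>k. qpoch_inf q w * t k)"
    by (simp add: qphi_def)
  also have "\<dots> = qpoch_inf q w * (\<Sum>k. t k)"
  proof (rule suminf_mult)
    define r where "r = (\<lambda>k. - (of_real q ^ k * z)
                            / ((1 - w * of_real q ^ k) * (1 - of_real q * of_real q ^ k)))"
    have exponent: "Suc k * k div 2 = k * (k - 1) div 2 + k" for k :: nat
    proof (cases k)
      case (Suc j)
      have "Suc k * k = k * (k - 1) + k * 2"
        unfolding Suc by (simp add: algebra_simps)
      thus ?thesis by simp
    qed simp
    have t_Suc: "t (Suc k) = r k * t k" for k
    proof -
      have "of_real q ^ (Suc k * k div 2) = (of_real q ^ (k * (k - 1) div 2) * of_real q ^ k :: complex)"
        unfolding exponent power_add ..
      thus ?thesis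
        by (simp add: t_def r_def qpoch_def mult_ac del: mult_Suc)
    qed
    have pow0: "(\<lambda>k. of_real q ^ k :: complex) \<longlonglongrightarrow> 0"
      using q by (intro LIMSEQ_power_zero) simp
    have "r \<longlonglongrightarrow> - (0 * z) / ((1 - w * 0) * (1 - of_real q * 0))"
      unfolding r_def by (intro tendsto_intros pow0) simp
    hence "(\<lambda>k. norm (r k)) \<longlonglongrightarrow> 0"
      by (simp add: tendsto_norm_zero)
    hence "eventually (\<lambda>k. norm (r k) < 1 / 2) sequentially"
      by (rule order_tendstoD) simp
    then obtain M where M: "norm (r k) < 1 / 2" if "k \<ge> M" for k
      unfolding eventually_sequentially by blast
    show "summable t"
    proof (rule summable_ratio_test)
      show "norm (t (Suc k)) \<le> 1 / 2 * norm (t k)" if "k \<ge> M" for k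
        unfolding t_Suc norm_mult using M[OF that] by (intro mult_right_mono) auto
    qed simp
  qed
  finally show ?thesis
    by (simp add: phi11_def t_def)
qed

end

(*
  Both factors with index N are the coefficient of t^N in the Laurent series of
  (z/t;q)_inf / (zt;q)_inf on the unit circle |t| = 1: for the first one this is a Cauchy product,
  and the second one agrees with it because, by Euler's expansion of (w q^k;q)_inf,
  (w;q)_inf 1phi1(0;w;q,z) is a double series symmetric in w and z.  The generating function times
  its reflection t -> 1/t is 1, and the coefficients of that product are the sums to be evaluated.
  In coefficient form this is a rearrangement of an absolutely convergent triple series together
  with the identity that the coefficients of 1/(zt;q)_inf and (zt;q)_inf convolve to delta.
  Absolute values of coefficients at |z| = r majorise everything on |z| <= r.
*)
theory Submission
  imports Defs
begin

no_notation Infinite_Set_Sum.abs_summable_on (infix \<open>abs'_summable'_on\<close> 50)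

section \<open>Products and reindexing of absolutely summable families\<close>

lemma abs_summable_on_times:
  fixes f :: "'a \<Rightarrow> 'c :: real_normed_div_algebra" and g :: "'b \<Rightarrow> 'c"
  assumes "f abs_summable_on A" "g abs_summable_on B"
  shows "(\<lambda>(x, y). f x * g y) abs_summable_on A \<times> B"
proof -
  have "(\<lambda>x. \<bar>\<Sum>\<^sub>\<infinity>y\<in>B. norm (f x) * norm (g y)\<bar>) summable_on A"
    using assms(1) by (simp add: infsum_cmult_right' abs_mult summable_on_cmult_left)
  moreover have "(\<lambda>y. norm (f x) * norm (g y)) summable_on B" for x
    using assms(2) by (intro summable_on_cmult_right)
  ultimately show ?thesis
    unfolding Infinite_Sum.abs_summable_on_Sigma_iff by (simp add: norm_mult)
qed

lemma abs_summable_on_compose_inj: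
  assumes "f abs_summable_on UNIV" "inj h"
  shows "(\<lambda>x. f (h x)) abs_summable_on UNIV"
proof -
  have "f abs_summable_on range h"
    using assms(1) by (rule summable_on_subset_banach) simp
  thus ?thesis
    using assms(2) by (simp add: summable_on_reindex o_def)
qed

section \<open>Correlations of two absolutely summable sequences\<close>

locale abs_summable_sequences =
  fixes a :: "int \<Rightarrow> 'a :: {real_normed_field, banach}" and b :: "nat \<Rightarrow> 'a"
  assumes a: "a abs_summable_on UNIV" and b: "b abs_summable_on UNIV"
begin

text \<open>The coefficient of \<open>t^N\<close> in the product of the series with terms
  \<open>a i t^i\<close> and \<open>b j t^(-j)\<close>. The sequences stay abstract because they are
  instantiated twice: with the complex coefficients and with their absolute values.\<close>

definition corr :: "int \<Rightarrow> 'a" where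
  "corr N = (\<Sum>\<^sub>\<infinity>j. a (N + int j) * b j)"

lemma abs_summable_corr_terms: "(\<lambda>j. a (N + int j) * b j) abs_summable_on UNIV"
proof -
  have "(\<lambda>(i, j). a i * b j) abs_summable_on UNIV \<times> UNIV"
    by (intro abs_summable_on_times a b)
  from abs_summable_on_compose_inj[OF this[simplified], of "\<lambda>j. (N + int j, j)"]
  show ?thesis by (simp add: inj_def)
qed

text \<open>Pullback of a product family over two index pairs along an injection: \<open>j\<close>
  and \<open>l\<close> are kept, and \<open>k\<close> is recovered from
  \<open>k + n + j\<close>.\<close>

lemma abs_summable_triple:
  "(\<lambda>(k, j, l). (a (k + n + int j) * b j) * (a (k + m + int l) * b l)) abs_summable_on UNIV"
proof -
  have "(\<lambda>(x, y). (case x of (i, j) \<Rightarrow> a i * b j) * (case y of (i, j) \<Rightarrow> a i * b j))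
          abs_summable_on (UNIV \<times> UNIV) \<times> (UNIV \<times> UNIV)"
    by (intro abs_summable_on_times a b)
  from abs_summable_on_compose_inj[OF this[simplified],
         of "\<lambda>(k, j, l). ((k + n + int j, j), (k + m + int l, l))"]
  show ?thesis by (simp add: inj_def case_prod_unfold)
qed

lemma has_sum_corr_pair:
  "((\<lambda>(j, l). (a (k + n + int j) * b j) * (a (k + m + int l) * b l))
     has_sum corr (k + n) * corr (k + m)) UNIV"
proof -
  let ?f = "\<lambda>(j, l). (a (k + n + int j) * b j) * (a (k + m + int l) * b l)"
  have "?f abs_summable_on UNIV \<times> UNIV"
    by (intro abs_summable_on_times abs_summable_corr_terms)
  hence "?f summable_on UNIV \<times> UNIV"
    by (rule abs_summable_summable)
  moreover from infsum_Sigma_banach[OF this]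
  have "infsum ?f (UNIV \<times> UNIV) = corr (k + n) * corr (k + m)"
    by (simp add: infsum_cmult_left' infsum_cmult_right' corr_def)
  ultimately show ?thesis
    by (simp add: has_sum_iff)
qed

text \<open>Free of the assumption \<open>conv\<close> of \<open>has_sum_corr_mult\<close>, so that
  it also covers absolute values of coefficients, whose convolution need not be a delta.\<close>

lemma summable_corr_mult: "(\<lambda>k. corr (k + n) * corr (k + m)) summable_on UNIV"
proof -
  have "(\<lambda>(k, j, l). (a (k + n + int j) * b j) * (a (k + m + int l) * b l))
          summable_on UNIV \<times> UNIV"
    using abs_summable_summable[OF abs_summable_triple[of n m]] by simp
  from has_sum_SigmaD[OF has_sum_infsum[OF this], where g = "\<lambda>k. corr (k + n) * corr (k + m)"]
  show ?thesis
    using has_sum_corr_pair by (auto simp: summable_on_def)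
qed

text \<open>The triple series is summed in two orders. For fixed \<open>k\<close> it yields the
  products of correlations. With \<open>s = k + n + j + l\<close> in place of \<open>k\<close>, the
  two \<open>b\<close> factors trade partners, and for fixed \<open>s\<close> the sum over
  \<open>(j, l)\<close> splits into the convolutions at \<open>s\<close> and at
  \<open>s - (n - m)\<close>, which are both deltas.\<close>

lemma has_sum_corr_mult:
  assumes conv: "\<And>s. (\<Sum>\<^sub>\<infinity>j. a (s - int j) * b j) = (if s = 0 then 1 else 0)"
  shows "((\<lambda>k. corr (k + n) * corr (k + m)) has_sum (if n = m then 1 else 0)) UNIV"
proof -
  let ?F = "\<lambda>(k, j, l). (a (k + n + int j) * b j) * (a (k + m + int l) * b l)"
  let ?G = "\<lambda>(s, j, l). (a (s - int l) * b l) * (a (s - (n - m) - int j) * b j)"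
  have "?F summable_on UNIV"
    by (rule abs_summable_summable[OF abs_summable_triple])
  then obtain S where S: "(?F has_sum S) UNIV"
    by (auto simp: summable_on_def)
  have corr: "((\<lambda>k. corr (k + n) * corr (k + m)) has_sum S) UNIV"
    using has_sum_SigmaD[where f = ?F and S = S and A = UNIV and B = "\<lambda>_. UNIV"
        and g = "\<lambda>k. corr (k + n) * corr (k + m)"] S has_sum_corr_pair by simp
  have "(?G has_sum S) UNIV \<longleftrightarrow> (?F has_sum S) UNIV"
    by (rule has_sum_reindex_bij_witness[of _ "\<lambda>(k, j, l). (k + n + int j + int l, j, l)"
          "\<lambda>(s, j, l). (s - n - int j - int l, j, l)"]) (auto simp: algebra_simps)
  with S have G: "(?G has_sum S) (UNIV \<times> UNIV)"
    by simp
  have G_inner: "((\<lambda>p. ?G (s, p)) has_sum (if s = 0 then 1 else 0) * (if s - (n - m) = 0 then 1 else 0)) UNIV" for s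
  proof -
    have summ: "(\<lambda>j. a (s - int j) * b j) abs_summable_on UNIV" for s
    proof -
      have "(\<lambda>(i, j). a i * b j) abs_summable_on UNIV \<times> UNIV"
        by (intro abs_summable_on_times a b)
      from abs_summable_on_compose_inj[OF this[simplified], of "\<lambda>j. (s - int j, j)"]
      show ?thesis by (simp add: inj_def)
    qed
    let ?H = "\<lambda>(l, j). (a (s - int l) * b l) * (a (s - (n - m) - int j) * b j)"
    have "?H abs_summable_on UNIV \<times> UNIV"
      by (intro abs_summable_on_times summ)
    hence "?H summable_on UNIV \<times> UNIV"
      by (rule abs_summable_summable)
    moreover from infsum_Sigma_banach[OF this]
    have "infsum ?H (UNIV \<times> UNIV) = (if s = 0 then 1 else 0) * (if s - (n - m) = 0 then 1 else 0)"
      unfolding conv[symmetric] by (simp add: infsum_cmult_left' infsum_cmult_right')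
    ultimately have "(?H has_sum (if s = 0 then 1 else 0) * (if s - (n - m) = 0 then 1 else 0)) (UNIV \<times> UNIV)"
      by (simp add: has_sum_iff)
    \<comment> \<open>\<open>?G\<close> lists the inner pair as \<open>(j, l)\<close>,
      \<open>?H\<close> as \<open>(l, j)\<close>.\<close>
    thus ?thesis
      by (subst (asm) has_sum_swap) (simp add: case_prod_unfold)
  qed
  have "((\<lambda>s. (if s = 0 then 1 else 0) * (if s - (n - m) = 0 then 1 else 0) :: 'a) has_sum S) UNIV"
    using G by (rule has_sum_SigmaD) (rule G_inner)
  \<comment> \<open>Only \<open>s = 0\<close> survives the first delta, and there the second one
    asks for \<open>n = m\<close>.\<close>
  moreover have "((\<lambda>s. (if s = 0 then 1 else 0) * (if s - (n - m) = 0 then 1 else 0) :: 'a)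
                    has_sum (if n = m then 1 else 0)) UNIV"
    by (rule has_sum_finite_neutralI[of "{0}"]) auto
  ultimately have "S = (if n = m then 1 else 0)"
    by (rule has_sum_unique)
  with corr show ?thesis
    by simp
qed

end


section \<open>The two coefficient sequences: recursions, absolute convergence, convolution\<close>

lemma summable_norm_ratio:
  fixes f :: "nat \<Rightarrow> 'a :: real_normed_field"
  assumes f_Suc: "\<And>k. f (Suc k) = r k * f k" and r: "r \<longlonglongrightarrow> L" and L: "norm L < 1"
  shows "summable (\<lambda>k. norm (f k))"
proof -
  obtain c where c: "norm L < c" "c < 1"
    using L dense by blast
  have "eventually (\<lambda>k. norm (r k) < c) sequentially"
    using tendsto_norm[OF r] c(1) by (rule order_tendstoD)
  then obtain M where M: "norm (r k) < c" if "k \<ge> M" for k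
    unfolding eventually_sequentially by blast
  show ?thesis
  proof (rule summable_ratio_test[OF c(2)])
    show "norm (norm (f (Suc k))) \<le> c * norm (norm (f k))" if "k \<ge> M" for k
      unfolding f_Suc norm_mult using M[OF that] by (auto intro!: mult_right_mono simp: norm_mult)
  qed
qed

text \<open>Coefficients of \<open>t\<^sup>i\<close> in \<open>1 / (z t; q)\<^sub>\<infinity>\<close> and of \<open>t\<^sup>j\<close> in \<open>(z t; q)\<^sub>\<infinity>\<close>.\<close>

definition coeff_inv :: "real \<Rightarrow> complex \<Rightarrow> int \<Rightarrow> complex" where
  "coeff_inv q z i = (if i < 0 then 0 else z ^ nat i / qpoch q (of_real q) (nat i))"

definition coeff_inf :: "real \<Rightarrow> complex \<Rightarrow> nat \<Rightarrow> complex" where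
  "coeff_inf q z j = (-1) ^ j * of_real q ^ (j * (j - 1) div 2) * z ^ j / qpoch q (of_real q) j"

lemma coeff_inf_0 [simp]: "coeff_inf q z 0 = 1"
  by (simp add: coeff_inf_def qpoch_def)

lemma coeff_inf_mult: "coeff_inf q (c * z) j = c ^ j * coeff_inf q z j"
  by (simp add: coeff_inf_def power_mult_distrib mult_ac)

lemma coeff_inf_rescale: "coeff_inf q z j = coeff_inf q 1 j * z ^ j"
  by (simp add: coeff_inf_def)

context
  fixes q :: real
  assumes q: "0 < q" "q < 1"
begin

lemma one_minus_q_power_neq_0: "1 - complex_of_real q * of_real q ^ j \<noteq> 0"
proof -
  have "q ^ Suc j < 1"
    using q by (intro power_Suc_less_one) auto
  hence "complex_of_real (q ^ Suc j) \<noteq> 1"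
    unfolding of_real_eq_1_iff by simp
  thus ?thesis by simp
qed

lemma qpoch_q_neq_0: "qpoch q (of_real q) k \<noteq> 0"
  unfolding qpoch_def using one_minus_q_power_neq_0 by simp

lemma qpoch_inf_q_neq_0: "qpoch_inf q (of_real q) \<noteq> 0"
proof -
  let ?f = "\<lambda>j. 1 - complex_of_real q * of_real q ^ j"
  have conv: "convergent_prod ?f"
    by (rule convergent_prod_qpoch[OF q])
  have "(\<lambda>n. \<Prod>j\<le>n. ?f j) \<longlonglongrightarrow> qpoch_inf q (of_real q)"
    using LIMSEQ_Suc[OF qpoch_tendsto[OF q, of "of_real q"]]
    by (simp add: qpoch_def lessThan_Suc_atMost)
  moreover have "(\<lambda>n. \<Prod>j\<le>n. ?f j) \<longlonglongrightarrow> prodinf ?f"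
    by (rule convergent_prod_LIMSEQ[OF conv])
  ultimately have "qpoch_inf q (of_real q) = prodinf ?f"
    by (rule LIMSEQ_unique)
  thus ?thesis
    using prodinf_nonzero[OF conv] one_minus_q_power_neq_0 by simp
qed

text \<open>Source of the zero coefficients at negative index: for \<open>i < 0\<close> the factor
  with \<open>j = - i - 1\<close> is \<open>1 - q^(i+1) q^j = 0\<close>. For \<open>i >= 0\<close>
  the first \<open>i\<close> factors of \<open>(q;q)_inf\<close> are split off.\<close>

lemma qpoch_inf_q_powi:
  "qpoch_inf q (of_real q powi (i + 1)) / qpoch_inf q (of_real q) =
     (if i < 0 then 0 else 1 / qpoch q (of_real q) (nat i))"
proof (cases "i < 0")
  case True
  define j where "j = nat (- i - 1)"
  have i: "i + 1 = - int j"
    using True by (simp add: j_def)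
  have "1 - of_real q powi (i + 1) * complex_of_real q ^ j = 0"
    using q by (simp add: i power_int_minus)
  hence "qpoch q (of_real q powi (i + 1)) (Suc j) = 0"
    by (simp add: qpoch_def)
  thus ?thesis
    using True qpoch_inf_split[OF q, of "of_real q powi (i + 1)" "Suc j"] by simp
next
  case False
  then obtain k where k: "i = int k"
    by (metis nonneg_int_cases not_less)
  have "of_real q powi (i + 1) = complex_of_real q ^ k * of_real q"
    unfolding k by (simp flip: power_int_of_nat add: power_int_add q less_imp_neq[OF q(1)])
  thus ?thesis
    using qpoch_inf_split[OF q, of "of_real q" k] qpoch_inf_q_neq_0 qpoch_q_neq_0[of k]
    by (simp add: k field_simps)
qed

lemma coeff_inf_Suc:
  "coeff_inf q z (Suc j) = - (of_real q ^ j * z) / (1 - of_real q * of_real q ^ j) * coeff_inf q z j"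
proof -
  have "Suc j * j = j * (j - 1) + j * 2"
    by (cases j) (auto simp: algebra_simps)
  hence "Suc j * j div 2 = j * (j - 1) div 2 + j"
    by simp
  hence "of_real q ^ (Suc j * j div 2) = (of_real q ^ (j * (j - 1) div 2) * of_real q ^ j :: complex)"
    by (simp only: power_add)
  thus ?thesis
    by (simp add: coeff_inf_def qpoch_def mult_ac del: mult_Suc)
qed

lemma of_real_power_tendsto_0: "(\<lambda>k. of_real q ^ k :: complex) \<longlonglongrightarrow> 0"
  using q by (intro LIMSEQ_power_zero) simp

lemma summable_coeff_inf: "summable (\<lambda>j. norm (coeff_inf q z j))"
proof (rule summable_norm_ratio)
  show "coeff_inf q z (Suc j) = - (of_real q ^ j * z) / (1 - of_real q * of_real q ^ j) * coeff_inf q z j" for j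
    by (rule coeff_inf_Suc)
  show "(\<lambda>j. - (of_real q ^ j * z) / (1 - of_real q * of_real q ^ j)) \<longlonglongrightarrow>
          - (0 * z) / (1 - of_real q * 0)"
    by (intro tendsto_intros of_real_power_tendsto_0) simp
qed simp

lemma abs_summable_coeff_inf: "coeff_inf q z abs_summable_on UNIV"
  using summable_coeff_inf by (simp add: summable_on_UNIV_nonneg_real_iff)

text \<open>The ratio of successive terms tends to \<open>z\<close>, which is where the unit disk
  enters; for \<open>coeff_inf\<close> the ratio tends to 0 and every \<open>z\<close> is
  allowed.\<close>

lemma abs_summable_coeff_inv:
  assumes "norm z < 1"
  shows "coeff_inv q z abs_summable_on UNIV"
proof -
  let ?f = "\<lambda>i. z ^ i / qpoch q (of_real q) i"
  have "summable (\<lambda>i. norm (?f i))"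
  proof (rule summable_norm_ratio)
    show "?f (Suc i) = z / (1 - of_real q * of_real q ^ i) * ?f i" for i
      by (simp add: qpoch_def)
    show "(\<lambda>i. z / (1 - of_real q * of_real q ^ i)) \<longlonglongrightarrow> z / (1 - of_real q * 0)"
      by (intro tendsto_intros of_real_power_tendsto_0) simp
  qed (use assms in simp)
  hence "(\<lambda>i. norm (?f i)) summable_on UNIV"
    by (simp add: summable_on_UNIV_nonneg_real_iff)
  also have "?this \<longleftrightarrow> (\<lambda>i. norm (coeff_inv q z i)) summable_on range int"
    by (subst summable_on_reindex) (auto simp: o_def coeff_inv_def)
  also have "\<dots> \<longleftrightarrow> (\<lambda>i. norm (coeff_inv q z i)) summable_on UNIV"
  proof (rule summable_on_cong_neutral)
    show "norm (coeff_inv q z i) = 0" if "i \<in> UNIV - range int" for i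
      using that by (auto simp: coeff_inv_def) (metis nonneg_int_cases not_less rangeI)
  qed auto
  finally show ?thesis .
qed

text \<open>
  With \<open>1 - q\<^bsup>i+j\<^esup> = (1 - q\<^sup>j) + q\<^sup>j (1 - q\<^sup>i)\<close> the coefficient recursions turn
  \<open>1 - q\<^sup>s\<close> times the convolution into two sums that cancel.
\<close>

lemma sum_coeff_conv:
  assumes "s > 0"
  shows "(\<Sum>j\<le>s. 1 / qpoch q (of_real q) (s - j) * coeff_inf q 1 j) = 0"
proof -
  define Q where "Q = complex_of_real q"
  define u where "u = (\<lambda>i. 1 / qpoch q Q i)"
  define v where "v = coeff_inf q 1"
  obtain t where t: "s = Suc t"
    using assms gr0_implies_Suc by blast
  have nz: "1 - Q ^ Suc j \<noteq> 0" for j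
    using one_minus_q_power_neq_0[of j] by (simp add: Q_def)
  have u_Suc: "(1 - Q ^ Suc i) * u (Suc i) = u i" for i
    using nz[of i] by (simp add: u_def qpoch_def Q_def)
  have v_Suc: "(1 - Q ^ Suc j) * v (Suc j) = - (Q ^ j) * v j" for j
    using nz[of j] by (simp add: v_def coeff_inf_Suc Q_def field_simps)
  have "(1 - Q ^ s) * (\<Sum>j\<le>s. u (s - j) * v j) =
          (\<Sum>j\<le>s. u (s - j) * ((1 - Q ^ j) * v j)) + (\<Sum>j\<le>s. Q ^ j * ((1 - Q ^ (s - j)) * u (s - j)) * v j)"
    unfolding sum_distrib_left sum.distrib[symmetric]
  proof (rule sum.cong)
    fix j assume "j \<in> {..s}"
    hence "Q ^ s = Q ^ j * Q ^ (s - j)"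
      by (simp flip: power_add)
    thus "(1 - Q ^ s) * (u (s - j) * v j) =
            u (s - j) * ((1 - Q ^ j) * v j) + Q ^ j * ((1 - Q ^ (s - j)) * u (s - j)) * v j"
      by (simp add: algebra_simps)
  qed simp
  \<comment> \<open>The term \<open>j = 0\<close> drops out because \<open>1 - Q^0 = 0\<close>, and
    the rest is shifted by one. In the second sum the same happens at \<open>j = s\<close>.\<close>
  also have "(\<Sum>j\<le>s. u (s - j) * ((1 - Q ^ j) * v j)) = (\<Sum>j\<le>t. u (t - j) * (- (Q ^ j) * v j))"
    unfolding t sum.atMost_Suc_shift v_Suc by simp
  also have "(\<Sum>j\<le>s. Q ^ j * ((1 - Q ^ (s - j)) * u (s - j)) * v j) = (\<Sum>j\<le>t. Q ^ j * u (t - j) * v j)"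
  proof -
    have "(1 - Q ^ (Suc t - j)) * u (Suc t - j) = u (t - j)" if "j \<le> t" for j
      using that u_Suc[of "t - j"] by (simp only: Suc_diff_le)
    hence "(\<Sum>j\<le>t. Q ^ j * ((1 - Q ^ (Suc t - j)) * u (Suc t - j)) * v j) = (\<Sum>j\<le>t. Q ^ j * u (t - j) * v j)"
      by (intro sum.cong) (simp_all only: atMost_iff)
    thus ?thesis
      by (simp add: t)
  qed
  also have "(\<Sum>j\<le>t. u (t - j) * (- (Q ^ j) * v j)) + (\<Sum>j\<le>t. Q ^ j * u (t - j) * v j) = 0"
    by (simp flip: sum.distrib add: mult_ac)
  finally show ?thesis
    using nz[of t] by (simp add: t u_def v_def Q_def)
qed

text \<open>Coefficient form of \<open>(zt;q)_inf / (zt;q)_inf = 1\<close>. The terms with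
  \<open>j > s\<close> vanish, and the others are homogeneous of degree \<open>s\<close> in
  \<open>z\<close>, which reduces the claim to \<open>z = 1\<close>.\<close>

lemma infsum_coeff_conv:
  "(\<Sum>\<^sub>\<infinity>j. coeff_inv q z (s - int j) * coeff_inf q z j) = (if s = 0 then 1 else 0)"
proof (cases "s < 0")
  case True
  thus ?thesis
    by (simp add: coeff_inv_def)
next
  case False
  then obtain k where k: "s = int k"
    by (metis nonneg_int_cases not_less)
  have "(\<Sum>\<^sub>\<infinity>j. coeff_inv q z (s - int j) * coeff_inf q z j) =
          (\<Sum>\<^sub>\<infinity>j\<in>{..k}. coeff_inv q z (s - int j) * coeff_inf q z j)"
    by (rule infsum_cong_neutral) (auto simp: k coeff_inv_def)
  also have "\<dots> = (\<Sum>j\<le>k. coeff_inv q z (s - int j) * coeff_inf q z j)"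
    by simp
  also have "\<dots> = (\<Sum>j\<le>k. z ^ k * (1 / qpoch q (of_real q) (k - j) * coeff_inf q 1 j))"
  proof (rule sum.cong)
    fix j assume j: "j \<in> {..k}"
    have "z ^ k = z ^ (k - j) * z ^ j"
      using j by (simp flip: power_add)
    moreover have "nat (int k - int j) = k - j"
      by simp
    ultimately show "coeff_inv q z (s - int j) * coeff_inf q z j =
            z ^ k * (1 / qpoch q (of_real q) (k - j) * coeff_inf q 1 j)"
      using j by (subst coeff_inf_rescale) (simp add: coeff_inv_def k)
  qed simp
  also have "\<dots> = z ^ k * (\<Sum>j\<le>k. 1 / qpoch q (of_real q) (k - j) * coeff_inf q 1 j)"
    by (simp only: sum_distrib_left)
  also have "\<dots> = (if s = 0 then 1 else 0)"
    using sum_coeff_conv[of k] by (cases "k = 0") (auto simp: k qpoch_def)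
  finally show ?thesis .
qed

section \<open>Euler's expansion and the symmetry of \<open>qphi\<close>\<close>

text \<open>The sum \<open>f\<close> satisfies \<open>f w = (1 - w) f (q w)\<close>, the functional
  equation of \<open>(w;q)_inf\<close>. Iterating it pushes the argument to 0, where
  \<open>f\<close> is continuous with value 1.\<close>

lemma coeff_inf_sums_qpoch_inf: "coeff_inf q w sums qpoch_inf q w"
proof -
  define f where "f = (\<lambda>w. \<Sum>j. coeff_inf q w j)"
  have summ: "summable (coeff_inf q w)" for w
    by (rule summable_norm_cancel[OF summable_coeff_inf])
  have f_Suc: "f w - 1 = (\<Sum>j. coeff_inf q w (Suc j))" for w
    using suminf_split_head[OF summ] by (simp add: f_def)
  have fun_eq: "f w = (1 - w) * f (of_real q * w)" for w
  proof -
    \<comment> \<open>Passing from \<open>w\<close> to \<open>q w\<close> multiplies coefficient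
      \<open>j\<close> by \<open>q^j\<close>, so this is the recursion \<open>coeff_inf_Suc\<close>
      cleared of its denominator \<open>1 - q^(j+1)\<close>.\<close>
    have "coeff_inf q w (Suc j) = coeff_inf q (of_real q * w) (Suc j) - w * coeff_inf q (of_real q * w) j" for j
      using one_minus_q_power_neq_0[of j]
      by (simp add: coeff_inf_mult coeff_inf_Suc divide_simps) (simp add: algebra_simps)
    hence "f w - 1 = (\<Sum>j. coeff_inf q (of_real q * w) (Suc j) - w * coeff_inf q (of_real q * w) j)"
      by (simp add: f_Suc)
    also have "\<dots> = (\<Sum>j. coeff_inf q (of_real q * w) (Suc j)) - w * f (of_real q * w)"
      unfolding f_def
      by (subst suminf_diff[symmetric])
         (auto simp: suminf_mult summ summable_Suc_iff intro!: summable_mult summ)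
    also have "\<dots> = f (of_real q * w) - 1 - w * f (of_real q * w)"
      by (simp add: f_Suc)
    finally show ?thesis
      by (simp add: algebra_simps)
  qed
  have iter: "f w = qpoch q w n * f (of_real q ^ n * w)" for n
  proof (induction n)
    case (Suc n)
    thus ?case
      using fun_eq[of "of_real q ^ n * w"] by (simp add: qpoch_def mult_ac)
  qed (simp add: qpoch_def)
  have "isCont f 0"
  proof -
    have "f = (\<lambda>w. \<Sum>j. coeff_inf q 1 j * w ^ j)"
      unfolding f_def by (intro ext suminf_cong coeff_inf_rescale)
    thus ?thesis
      using isCont_powser[of "coeff_inf q 1" 1 0] summ[of 1] by simp
  qed
  moreover have "(\<lambda>n. of_real q ^ n * w) \<longlonglongrightarrow> 0"
    using tendsto_mult_left_zero[OF of_real_power_tendsto_0] .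
  ultimately have "(\<lambda>n. f (of_real q ^ n * w)) \<longlonglongrightarrow> f 0"
    by (rule isCont_tendsto_compose)
  hence "(\<lambda>n. qpoch q w n * f (of_real q ^ n * w)) \<longlonglongrightarrow> qpoch_inf q w * f 0"
    by (intro tendsto_mult qpoch_tendsto q)
  moreover have "f 0 = 1"
    using f_Suc[of 0] by (simp add: coeff_inf_def)
  ultimately have "(\<lambda>_. f w) \<longlonglongrightarrow> qpoch_inf q w"
    unfolding iter[symmetric] by simp
  hence "f w = qpoch_inf q w"
    by (rule LIMSEQ_unique[OF tendsto_const])
  thus ?thesis
    using summable_sums[OF summ[of w]] by (simp add: f_def)
qed

lemma qphi_terms_has_sum:
  "((\<lambda>j. coeff_inf q z k * (coeff_inf q w j * of_real q ^ (k * j))) has_sum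
     coeff_inf q z k * qpoch_inf q (of_real q ^ k * w)) UNIV"
proof -
  have "(coeff_inf q (of_real q ^ k * w) has_sum qpoch_inf q (of_real q ^ k * w)) UNIV"
    by (rule norm_summable_imp_has_sum[OF summable_coeff_inf coeff_inf_sums_qpoch_inf])
  thus ?thesis
    unfolding coeff_inf_mult by (intro has_sum_cmult_right) (simp add: power_mult[symmetric] mult.commute)
qed

text \<open>Since \<open>q^(k j)\<close> is at most 1, the double family is dominated by a product
  of two absolutely summable ones; summing over \<open>j\<close> first recovers the defining
  series.\<close>

lemma qphi_has_sum:
  "((\<lambda>(k, j). coeff_inf q z k * (coeff_inf q w j * of_real q ^ (k * j))) has_sum qphi q w z) UNIV"
  (is "(?f has_sum _) _")
proof -
  have "?f abs_summable_on UNIV \<times> UNIV"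
  proof (rule Infinite_Sum.abs_summable_on_comparison_test)
    show "(\<lambda>(k, j). coeff_inf q z k * coeff_inf q w j) abs_summable_on UNIV \<times> UNIV"
      by (intro abs_summable_on_times abs_summable_coeff_inf)
    show "norm (?f p) \<le> norm (case p of (k, j) \<Rightarrow> coeff_inf q z k * coeff_inf q w j)" for p
      using q by (auto simp: norm_mult norm_power case_prod_unfold power_le_one
                       intro!: mult_left_mono mult_left_le)
  qed
  hence "?f summable_on UNIV \<times> UNIV"
    by (rule abs_summable_summable)
  then obtain S where S: "(?f has_sum S) (UNIV \<times> UNIV)"
    by (auto simp: summable_on_def)
  hence "((\<lambda>k. coeff_inf q z k * qpoch_inf q (of_real q ^ k * w)) has_sum S) UNIV"
    by (rule has_sum_SigmaD) (use qphi_terms_has_sum in simp)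
  from has_sum_imp_sums[OF this] have "S = qphi q w z"
    by (simp add: qphi_def coeff_inf_def sums_iff mult_ac)
  with S show ?thesis
    by simp
qed

text \<open>By Euler's expansion of \<open>(w q\<^sup>k; q)\<^sub>\<infinity>\<close>, both sides are the same double series.\<close>

lemma qphi_commute: "qphi q w z = qphi q z w"
proof -
  have "((\<lambda>(k, j). coeff_inf q z k * (coeff_inf q w j * of_real q ^ (k * j))) has_sum qphi q w z) (UNIV \<times> UNIV)"
    using qphi_has_sum by simp
  hence "((\<lambda>(k, j). coeff_inf q w k * (coeff_inf q z j * of_real q ^ (k * j))) has_sum qphi q w z) UNIV"
    by (subst (asm) has_sum_swap) (simp add: mult_ac case_prod_unfold)
  thus ?thesis
    using qphi_has_sum has_sum_unique by blast
qed


section \<open>Identification of the coefficients with \<open>qphi\<close>\<close>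

lemma abs_summable_sequences_coeff:
  "norm z < 1 \<Longrightarrow> abs_summable_sequences (coeff_inv q z) (coeff_inf q z)"
  by unfold_locales (auto intro: abs_summable_coeff_inv abs_summable_coeff_inf)

text \<open>Up to rescaling the argument and a constant factor, the Hahn-Exton q-Bessel function of
  order \<open>N\<close>. Nonzero terms contain \<open>z^(N+2j)\<close> with
  \<open>N + j >= 0\<close>, so no negative power occurs and \<open>z = 0\<close> needs no special
  treatment.\<close>

definition bessel :: "int \<Rightarrow> complex \<Rightarrow> complex" where
  "bessel N z = (\<Sum>\<^sub>\<infinity>j. coeff_inv q z (N + int j) * coeff_inf q z j)"

lemma bessel_eq_qphi:
  assumes "z \<noteq> 0"
  shows "z powi N * (qphi q (of_real q powi (N + 1)) (z\<^sup>2) / qpoch_inf q (of_real q)) = bessel N z"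
proof -
  let ?w = "complex_of_real q powi (N + 1)" and ?Q = "qpoch_inf q (of_real q)"
  have "((\<lambda>k. coeff_inf q (z\<^sup>2) k * qpoch_inf q (of_real q ^ k * ?w)) has_sum qphi q ?w (z\<^sup>2)) UNIV"
  proof (rule has_sum_SigmaD)
    show "((\<lambda>(k, j). coeff_inf q (z\<^sup>2) k * (coeff_inf q ?w j * of_real q ^ (k * j))) has_sum qphi q ?w (z\<^sup>2))
            (UNIV \<times> UNIV)"
      using qphi_has_sum by simp
  qed (use qphi_terms_has_sum in simp)
  hence "((\<lambda>k. z powi N / ?Q * (coeff_inf q (z\<^sup>2) k * qpoch_inf q (of_real q ^ k * ?w))) has_sum
           z powi N / ?Q * qphi q ?w (z\<^sup>2)) UNIV"
    by (rule has_sum_cmult_right)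
  moreover have "z powi N / ?Q * (coeff_inf q (z\<^sup>2) k * qpoch_inf q (of_real q ^ k * ?w)) =
                   coeff_inv q z (N + int k) * coeff_inf q z k" for k
  proof -
    have shift: "of_real q ^ k * ?w = of_real q powi (N + int k + 1)"
      using q by (simp add: power_int_add add_ac mult_ac)
    have "z powi N / ?Q * (coeff_inf q (z\<^sup>2) k * qpoch_inf q (of_real q ^ k * ?w)) =
            (z powi N * coeff_inf q (z\<^sup>2) k) * (qpoch_inf q (of_real q powi (N + int k + 1)) / ?Q)"
      unfolding shift by simp
    \<comment> \<open>Of the power \<open>z^(2k)\<close>, one half turns \<open>z^N\<close> into
      \<open>z^(N+k)\<close> and the other stays in \<open>coeff_inf\<close>. Negative
      \<open>N\<close> requires \<open>z\<close> to be nonzero here.\<close>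
    also have "z powi N * coeff_inf q (z\<^sup>2) k = z powi (N + int k) * coeff_inf q z k"
      using assms by (simp add: power2_eq_square coeff_inf_mult power_int_add)
    also have "\<dots> * (qpoch_inf q (of_real q powi (N + int k + 1)) / ?Q) =
                 coeff_inv q z (N + int k) * coeff_inf q z k"
      unfolding qpoch_inf_q_powi by (simp add: coeff_inv_def power_int_def)
    finally show ?thesis .
  qed
  ultimately show ?thesis
    by (simp add: bessel_def has_sum_iff mult_ac)
qed

section \<open>Majorants on closed disks and continuity at 0\<close>

text \<open>Each coefficient is a constant times a power of \<open>z\<close>, so its absolute value
  grows with that of \<open>z\<close>.\<close>

lemma norm_coeff_mult_le:
  assumes "norm z \<le> r"
  shows "norm (coeff_inv q z i * coeff_inf q z j) \<le>
           norm (coeff_inv q (of_real r) i) * norm (coeff_inf q (of_real r) j)"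
proof -
  have "norm z ^ k \<le> \<bar>r\<bar> ^ k" for k
    using assms by (intro power_mono) auto
  thus ?thesis
    unfolding norm_mult
    by (intro mult_mono)
       (auto simp: coeff_inv_def coeff_inf_def norm_mult norm_divide norm_power
             intro!: divide_right_mono mult_left_mono)
qed

text \<open>Bounds \<open>bessel N\<close> on the whole disk of radius \<open>r < 1\<close>. It is
  \<open>corr\<close> for the absolute values of the coefficients at \<open>r\<close>, so products
  of majorants are summable by the real instance of the locale.\<close>

definition majorant :: "real \<Rightarrow> int \<Rightarrow> real" where
  "majorant r N = (\<Sum>\<^sub>\<infinity>j. norm (coeff_inv q (of_real r) (N + int j)) * norm (coeff_inf q (of_real r) j))"

lemma summable_coeff_terms:
  assumes "norm z < 1"
  shows "(\<lambda>j. norm (coeff_inv q z (N + int j)) * norm (coeff_inf q z j)) summable_on UNIV"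
proof -
  interpret abs_summable_sequences "coeff_inv q z" "coeff_inf q z"
    by (rule abs_summable_sequences_coeff[OF assms])
  show ?thesis
    using abs_summable_corr_terms[of N] by (simp add: norm_mult)
qed

lemma norm_bessel_le:
  assumes "norm z \<le> r" "r < 1"
  shows "norm (bessel N z) \<le> majorant r N"
proof -
  have r: "norm (complex_of_real r) < 1"
    using assms order_trans[OF norm_ge_zero assms(1)] by simp
  have z: "norm z < 1"
    using assms by simp
  interpret abs_summable_sequences "coeff_inv q z" "coeff_inf q z"
    by (rule abs_summable_sequences_coeff[OF z])
  have "(\<lambda>j. coeff_inv q z (N + int j) * coeff_inf q z j) summable_on UNIV"
    by (rule abs_summable_summable[OF abs_summable_corr_terms])
  thus ?thesis
    unfolding bessel_def majorant_def
    by (rule norm_infsum_le[OF has_sum_infsum has_sum_infsum[OF summable_coeff_terms[OF r]]])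
       (rule norm_coeff_mult_le[OF assms(1)])
qed

lemma summable_majorant_mult:
  assumes "0 \<le> r" "r < 1"
  shows "(\<lambda>k. majorant r (k + n) * majorant r (k + m)) summable_on UNIV"
proof -
  have r: "norm (complex_of_real r) < 1"
    using assms by simp
  interpret abs_summable_sequences "\<lambda>i. norm (coeff_inv q (of_real r) i)" "\<lambda>j. norm (coeff_inf q (of_real r) j)"
    by unfold_locales (auto intro: abs_summable_coeff_inv[OF r] abs_summable_coeff_inf)
  show ?thesis
    using summable_corr_mult[of n m] by (simp add: corr_def majorant_def)
qed

lemma continuous_on_coeff_inv: "continuous_on A (\<lambda>z. coeff_inv q z i)"
  by (cases "i < 0") (auto simp: coeff_inv_def qpoch_q_neq_0 intro!: continuous_intros)

lemma continuous_on_coeff_inf: "continuous_on A (\<lambda>z. coeff_inf q z j)"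
  by (auto simp: coeff_inf_def qpoch_q_neq_0 intro!: continuous_intros)

text \<open>Supplies the limit that \<open>extend_at_0\<close> takes. The M-test is run on a disk
  around 0; the radius \<open>1/2\<close> is an arbitrary choice below 1.\<close>

lemma isCont_bessel_0: "isCont (bessel N) 0"
proof -
  have "uniform_limit (cball 0 (1/2))
          (\<lambda>X z. \<Sum>j\<in>X. coeff_inv q z (N + int j) * coeff_inf q z j)
          (\<lambda>z. \<Sum>\<^sub>\<infinity>j. coeff_inv q z (N + int j) * coeff_inf q z j) (finite_subsets_at_top UNIV)"
    using norm_coeff_mult_le[where r = "1/2"] summable_coeff_terms[of "of_real (1/2)" N]
    by (intro Weierstrass_m_test_general) auto
  hence "continuous_on (cball 0 (1/2)) (bessel N)"
    unfolding bessel_def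
    by (rule uniform_limit_theorem[rotated])
       (auto intro!: always_eventually continuous_intros continuous_on_coeff_inv continuous_on_coeff_inf)
  thus ?thesis
    by (rule continuous_on_interior) simp
qed

lemma extend_at_0_eq_bessel:
  assumes "\<And>z. z \<noteq> 0 \<Longrightarrow> f z = bessel N z"
  shows "extend_at_0 f = bessel N"
proof
  fix z
  have "f \<midarrow>0\<rightarrow> bessel N 0"
    using isCont_bessel_0[of N] assms by (simp add: isCont_def cong: LIM_cong)
  hence "Lim (at 0) f = bessel N 0"
    by (intro tendsto_Lim) auto
  thus "extend_at_0 f z = bessel N z"
    using assms by (simp add: extend_at_0_def)
qed

lemma factor1_eq_bessel: "factor1 q N = bessel N"
  unfolding factor1_def by (rule extend_at_0_eq_bessel) (rule bessel_eq_qphi)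

text \<open>Exchanging the arguments of \<open>qphi\<close> turns the second factor into the first,
  so both families of sums coincide.\<close>

lemma factor2_eq_bessel: "factor2 q N = bessel N"
  unfolding factor2_def
  by (rule extend_at_0_eq_bessel, subst qphi_commute) (rule bessel_eq_qphi)

section \<open>Orthogonality and locally uniform absolute convergence\<close>

lemma bessel_orthogonal:
  assumes "norm z < 1"
  shows "((\<lambda>k. bessel (k + n) z * bessel (k + m) z) has_sum (if n = m then 1 else 0)) UNIV"
proof -
  interpret abs_summable_sequences "coeff_inv q z" "coeff_inf q z"
    by (rule abs_summable_sequences_coeff[OF assms])
  show ?thesis
    using has_sum_corr_mult[OF infsum_coeff_conv, of n m] by (simp add: corr_def bessel_def)
qed

lemma abs_conv_compact_unif_bessel:
  "abs_conv_compact_unif (ball 0 1) (\<lambda>k z. bessel (k + n) z * bessel (k + m) z)"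
  unfolding abs_conv_compact_unif_def
proof safe
  have bound: "norm (bessel (k + n) z * bessel (k + m) z) \<le> majorant r (k + n) * majorant r (k + m)"
    if "norm z \<le> r" "r < 1" for k z r
    unfolding norm_mult using norm_bessel_le[OF that] order_trans[OF norm_ge_zero norm_bessel_le[OF that]]
    by (intro mult_mono) auto
  show "(\<lambda>k. bessel (k + n) z * bessel (k + m) z) abs_summable_on UNIV" if "z \<in> ball 0 1" for z
    using that summable_majorant_mult[of "norm z" n m] bound[of z "norm z"]
    by (intro Infinite_Sum.abs_summable_on_comparison_test') auto
  fix K :: "complex set"
  assume K: "compact K" "K \<subseteq> ball 0 1"
  \<comment> \<open>The largest norm attained on \<open>K\<close> serves as \<open>r\<close>; it is
    below 1 because \<open>K\<close> lies in the open disk. The empty set attains no maximum and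
    gets \<open>r = 0\<close>.\<close>
  obtain r where r: "0 \<le> r" "r < 1" "K \<subseteq> cball 0 r"
  proof (cases "K = {}")
    case True
    thus ?thesis using that[of 0] by simp
  next
    case False
    then obtain x where x: "x \<in> K" "\<And>y. y \<in> K \<Longrightarrow> norm y \<le> norm x"
      using continuous_attains_sup[OF K(1), of norm] by (auto intro: continuous_intros)
    thus ?thesis using that[of "norm x"] K(2) by (auto simp: subset_iff)
  qed
  show "uniform_limit K (\<lambda>F z. \<Sum>k\<in>F. norm (bessel (k + n) z * bessel (k + m) z))
          (\<lambda>z. \<Sum>\<^sub>\<infinity>k. norm (bessel (k + n) z * bessel (k + m) z)) (finite_subsets_at_top UNIV)"
    using bound r summable_majorant_mult[OF r(1,2), of n m]
    by (intro Weierstrass_m_test_general) auto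
qed

end

theorem proposition2p6:
  fixes q :: real and n m :: int
  assumes "0 < q" and "q < 1"
  shows "(\<forall>z. norm z < 1 \<longrightarrow>
            ((\<lambda>k. factor1 q (k + n) z * factor1 q (k + m) z) has_sum (if n = m then 1 else 0)) UNIV)
       \<and> (\<forall>z. norm z < 1 \<longrightarrow>
            ((\<lambda>k. factor2 q (k + n) z * factor2 q (k + m) z) has_sum (if n = m then 1 else 0)) UNIV)
       \<and> abs_conv_compact_unif (ball 0 1) (\<lambda>k z. factor1 q (k + n) z * factor1 q (k + m) z)
       \<and> abs_conv_compact_unif (ball 0 1) (\<lambda>k z. factor2 q (k + n) z * factor2 q (k + m) z)"
  unfolding factor1_eq_bessel[OF assms] factor2_eq_bessel[OF assms]
  using bessel_orthogonal[OF assms] abs_conv_compact_unif_bessel[OF assms] by blast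

end
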